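(* The associated chain of ideals of the family $\mathcal{E}_{<\omega} \subseteq {}^{\omega}\mathrm{Seq}$ is strictly increasing, i.e. $$\mathcal{I}_0(\mathcal{E}_{<\omega}) \subsetneq \mathcal{I}_0((\mathcal{E}_{<\omega})^2) \subsetneq \mathcal{I}_0((\mathcal{E}_{<\omega})^3) \subsetneq \dots$$
   Context: For countable sets $A,B$, functions $f,g \in {}^{A}B$ are eventually different if $E(f,g) := \{a \in A \mid f(a) = g(a)\}$ is finite. A family $\mathcal{F} \subseteq {}^{A}B$ is eventually different (ed) if its members are pairwise eventually different; it is maximal eventually different (med) if it is maximal under inclusion among ed families in ${}^{A}B$. With $(f_1\times\dots\times f_n)(a) := (f_1(a),\dots,f_n(a))$, put $\mathcal{F}^n := \{f_1\times\dots\times f_n \mid f_1,\dots,f_n\in\mathcal{F}\} \subseteq {}^{A}(B^n)$. For an ed family $\mathcal{F} \subseteq {}^{\omega}B$ the associated ideal is $\mathcal{I}_0(\mathcal{F}) := \{A \subseteq\omega \text{ infinite} \mid \{f\restriction A \mid f\in\mathcal{F}\} \text{ is not a maximal ed family in } {}^{A}B\} \cup \{A \subseteq \omega \mid A \text{ finite}\}$. Definition of $\mathcal{E}_{<\omega}$. Let $\mathrm{Seq} := {}^{<\omega}\omega$ be the set of finite sequences of natural numbers, $\mathrm{lh}(s)$ the length of $s$, and for $f\in{}^\omega\omega$ let $\mathrm{e}(f)\in{}^\omega\mathrm{Seq}$ be $\mathrm{e}(f)(k) := f\restriction k$. Let $\mathcal{R}_{<\omega} := \{(n,\vec h,i) \mid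 1\le n<\omega,\ \vec h = (h_0,\dots,h_{n-1})\in({}^{\omega}\mathrm{Seq})^n,\ i\in n\}$ (where $n=\{0,\dots,n-1\}$), and fix a computable bijection $\Phi_{<\omega}:\mathcal{R}_{<\omega}\to{}^\omega\omega$ with computable inverse. Fix a computable injective coding $(n,\vec h)\mapsto \ast(n,\vec h)$ of pairs consisting of a number $n\ge1$ and $\vec h\in({}^\omega\mathrm{Seq})^n$ by elements of ${}^\omega\mathrm{Seq}$, in which the first entry $\ast(n,\vec h)(0)$ determines $n$ (e.g. first record $n$ and then interleave $h_0,\dots,h_{n-1}$), and a computable injective coding $\langle\cdot\rangle$ of finite sequences of members of $\mathrm{Seq}$ by natural numbers. Let $B(n,\vec h) := \{2\langle \ast(n,\vec h)\restriction k\rangle+1 \mid k\in\omega\}$. For $h\in{}^\omega\mathrm{Seq}$ write $m\prec_h m'$ iff $m<m'$, $\mathrm{lh}(h(m))=m$, $\mathrm{lh}(h(m'))=m'$ and $h(m)\subsetneq h(m')$. For infinite $X\subseteq\omega$ let $T_X(h) := \{m\in X \mid m\not\prec_h m' \text{ for all } m'\in X\}$. If $T_X(h)$ is finite, the canonical strictly increasing chain in $X$ is $\{m_0<m_1<\dots\}$ where $m_0$ is the least element of $X$ such that $h(m_0)$ is longer than all $h(m)$ with $m\in T_X(h)$, and $m_{j+1}$ is the least element of $X$ with $m_j\prec_h m_{j+1}$ (this is well defined); its branch is $\bigcup_j h(m_j)\in{}^\omega\omega$. Fix $n\ge1$ and $\vec h=(h_0,\dots,h_{n-1})$. Let $X_0:=B(n,\vec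 h)$. Given $X_i$ ($i<n$): if $T_{X_i}(h_i)$ is infinite, set $X_{i+1}:=T_{X_i}(h_i)$ and call $i$ copyable; otherwise let $X_{i+1}$ be the canonical strictly increasing chain in $X_i$ for $h_i$, let $f_{h_i}$ be its branch, and call $i$ coherent. Let $S\subseteq n$ be the set of copyable and $T := n\setminus S$ the set of coherent coordinates. Define $k\equiv l$ on $X_n$ iff for all $i,j\in S$: $h_i(k)=h_j(k)\iff h_i(l)=h_j(l)$. Let $C(n,\vec h)$ be the first (in some fixed canonical ordering of the finitely many possible equality patterns on $S$) infinite $\equiv$-class. Define $i\sim j$ on $S$ iff $h_i(k)=h_j(k)$ for all $k\in C(n,\vec h)$; let $m$ be the number of $\sim$-classes and $\pi:S\to m$ the canonical quotient map. Let $\psi:m\to n$ be the injection listing, in increasing order, the first $m$ coordinates $c\in n$ such that $\Phi_{<\omega}(n,\vec h,c)\ne f_{h_j}$ for all $j\in T$ (there are at least $m$ such coordinates). For $a\in m$ set $\dot{\mathrm e}(n,\vec h,\psi(a))(k) := h_j(k)$ if $k\in C(n,\vec h)$, where $j$ is any element of $\pi^{-1}(a)$, and $:=\mathrm{e}(\Phi_{<\omega}(n,\vec h,\psi(a)))(k)$ otherwise. For $i\in n\setminus\mathrm{ran}(\psi)$ set $\dot{\mathrm e}(n,\vec h,i) := \mathrm{e}(\Phi_{<\omega}(n,\vec h,i))$. Finally $\mathcal{E}_{<\omega} := \{\dot{\mathrm e}(n,\vec h,i) \mid (n,\vec h,i)\in\mathcal{R}_{<\omega}\}$; it is a finitely productive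 med family in ${}^\omega\mathrm{Seq}$ (i.e. $(\mathcal{E}_{<\omega})^n$ is med for all $n\geq 1$). *)

theory Defs
  imports "HOL-Library.FuncSet" "HOL-Library.Sublist" "HOL-Library.Nat_Bijection"
begin

text \<open>The set of functions from \<open>A\<close> to \<open>B\<close> is \<open>A \<rightarrow>\<^sub>E B\<close>, the functions in it being undefined
  outside \<open>A\<close>.\<close>

definition eventually_different :: "'a set \<Rightarrow> ('a \<Rightarrow> 'b) \<Rightarrow> ('a \<Rightarrow> 'b) \<Rightarrow> bool" where
  "eventually_different A f g \<longleftrightarrow> finite {a \<in> A. f a = g a}"

definition ed_family :: "'a set \<Rightarrow> 'b set \<Rightarrow> ('a \<Rightarrow> 'b) set \<Rightarrow> bool" where
  "ed_family A B F \<longleftrightarrow> F \<subseteq> A \<rightarrow>\<^sub>E B \<and> pairwise (eventually_different A) F"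

definition med_family :: "'a set \<Rightarrow> 'b set \<Rightarrow> ('a \<Rightarrow> 'b) set \<Rightarrow> bool" where
  "med_family A B F \<longleftrightarrow> ed_family A B F \<and> (\<forall>G. ed_family A B G \<longrightarrow> F \<subseteq> G \<longrightarrow> G = F)"

text \<open>\<open>B\<^sup>n\<close> consists of the lists of length \<open>n\<close> over \<open>B\<close>.\<close>

definition set_power :: "'b set \<Rightarrow> nat \<Rightarrow> 'b list set" where
  "set_power B n = {xs. length xs = n \<and> set xs \<subseteq> B}"

definition fun_product :: "('a \<Rightarrow> 'b) list \<Rightarrow> 'a \<Rightarrow> 'b list" where
  "fun_product fs a = map (\<lambda>f. f a) fs"

definition family_power :: "(nat \<Rightarrow> 'b) set \<Rightarrow> nat \<Rightarrow> (nat \<Rightarrow> 'b list) set" where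
  "family_power F n = fun_product ` set_power F n"

definition ideal0 :: "'b set \<Rightarrow> (nat \<Rightarrow> 'b) set \<Rightarrow> nat set set" where
  "ideal0 B F = {A. infinite A \<and> \<not> med_family A B ((\<lambda>f. restrict f A) ` F)} \<union> {A. finite A}"

text \<open>Partial recursive functions relative to an oracle \<open>\<alpha>\<close>; \<open>rec_eval \<alpha> p xs y\<close> says that the
  program \<open>p\<close> with oracle \<open>\<alpha>\<close> halts on the arguments \<open>xs\<close> with value \<open>y\<close>.\<close>

datatype recf =
    RZero | RSucc | RProj nat | ROracle | RComp recf "recf list" | RPrec recf recf | RMu recf

inductive rec_eval :: "(nat \<Rightarrow> nat) \<Rightarrow> recf \<Rightarrow> nat list \<Rightarrow> nat \<Rightarrow> bool" for \<alpha> where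
  zero: "rec_eval \<alpha> RZero xs 0"
| succ: "rec_eval \<alpha> RSucc [x] (Suc x)"
| proj: "i < length xs \<Longrightarrow> rec_eval \<alpha> (RProj i) xs (xs ! i)"
| oracle_call: "rec_eval \<alpha> ROracle [x] (\<alpha> x)"
| comp: "list_all2 (\<lambda>g y. rec_eval \<alpha> g xs y) gs ys \<Longrightarrow> rec_eval \<alpha> f ys z
    \<Longrightarrow> rec_eval \<alpha> (RComp f gs) xs z"
| prec_0: "rec_eval \<alpha> f xs y \<Longrightarrow> rec_eval \<alpha> (RPrec f g) (0 # xs) y"
| prec_Suc: "rec_eval \<alpha> (RPrec f g) (x # xs) y \<Longrightarrow> rec_eval \<alpha> g (x # y # xs) z
    \<Longrightarrow> rec_eval \<alpha> (RPrec f g) (Suc x # xs) z"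
| mu: "rec_eval \<alpha> f (y # xs) 0 \<Longrightarrow> (\<forall>z<y. \<exists>w. rec_eval \<alpha> f (z # xs) (Suc w))
    \<Longrightarrow> rec_eval \<alpha> (RMu f) xs y"

text \<open>\<open>F\<close> is computable on \<open>X\<close> when one program computes a name of \<open>F x\<close> in \<open>\<omega>\<^sup>\<omega>\<close> from any oracle that
  is the name of some \<open>x \<in> X\<close>. The functions \<open>\<delta>\<close> and \<open>\<epsilon>\<close> assign the names of arguments and of
  values; each object has just one name.\<close>

definition computable_on ::
    "'x set \<Rightarrow> ('x \<Rightarrow> nat \<Rightarrow> nat) \<Rightarrow> ('y \<Rightarrow> nat \<Rightarrow> nat) \<Rightarrow> ('x \<Rightarrow> 'y) \<Rightarrow> bool" where
  "computable_on X \<delta> \<epsilon> F \<longleftrightarrow> (\<exists>p. \<forall>x\<in>X. \<forall>k. rec_eval (\<delta> x) p [k] (\<epsilon> (F x) k))"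

type_synonym seq = "nat list"
type_synonym seqfun = "nat \<Rightarrow> seq"

definition initial_segment :: "(nat \<Rightarrow> 'b) \<Rightarrow> nat \<Rightarrow> 'b list" where
  "initial_segment f k = map f [0..<k]"

definition e_map :: "(nat \<Rightarrow> nat) \<Rightarrow> seqfun" where
  "e_map f k = initial_segment f k"

text \<open>A vector of length \<open>n\<close> is a list of length \<open>n\<close>, its coordinates being numbered from \<open>0\<close>.\<close>

definition Vectors :: "(nat \<times> seqfun list) set" where
  "Vectors = {(n, hs). 1 \<le> n \<and> length hs = n}"

definition Requirements :: "(nat \<times> seqfun list \<times> nat) set" where
  "Requirements = {(n, hs, i). (n, hs) \<in> Vectors \<and> i < n}"

text \<open>Finite sequences are given by their code under the bijection \<open>list_encode\<close>. The name of
  \<open>(n, hs)\<close> lists \<open>n\<close> followed by the values of all coordinates, padded by \<open>0\<close> at the places that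
  belong to no coordinate.\<close>

definition name_seqfun :: "seqfun \<Rightarrow> nat \<Rightarrow> nat" where
  "name_seqfun h k = list_encode (h k)"

definition name_vector :: "nat \<times> seqfun list \<Rightarrow> nat \<Rightarrow> nat" where
  "name_vector = (\<lambda>(n, hs). case_nat n (\<lambda>p. case prod_decode p of (j, k) \<Rightarrow>
      if j < n then name_seqfun (hs ! j) k else 0))"

definition name_requirement :: "nat \<times> seqfun list \<times> nat \<Rightarrow> nat \<Rightarrow> nat" where
  "name_requirement = (\<lambda>(n, hs, i). case_nat i (name_vector (n, hs)))"

definition name_nat :: "nat \<Rightarrow> nat \<Rightarrow> nat" where
  "name_nat c = (\<lambda>_. c)"

definition name_seqs :: "seq list \<Rightarrow> nat \<Rightarrow> nat" where
  "name_seqs ss = name_nat (list_encode (map list_encode ss))"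

definition admissible_Phi :: "(nat \<times> seqfun list \<times> nat \<Rightarrow> nat \<Rightarrow> nat) \<Rightarrow> bool" where
  "admissible_Phi \<Phi> \<longleftrightarrow> bij_betw \<Phi> Requirements UNIV
     \<and> computable_on Requirements name_requirement id \<Phi>
     \<and> computable_on UNIV id name_requirement (inv_into Requirements \<Phi>)"

definition admissible_star :: "(nat \<times> seqfun list \<Rightarrow> seqfun) \<Rightarrow> bool" where
  "admissible_star star \<longleftrightarrow> inj_on star Vectors
     \<and> computable_on Vectors name_vector name_seqfun star
     \<and> (\<forall>(n, hs)\<in>Vectors. \<forall>(n', hs')\<in>Vectors. star (n, hs) 0 = star (n', hs') 0 \<longrightarrow> n = n')"

definition admissible_code :: "(seq list \<Rightarrow> nat) \<Rightarrow> bool" where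
  "admissible_code code \<longleftrightarrow> inj code \<and> computable_on UNIV name_seqs name_nat code"

text \<open>An equality pattern on \<open>S\<close> is an equivalence relation on \<open>S\<close>. An ordering of the finitely many
  patterns is given by an injective ranking by natural numbers.\<close>

definition admissible_rank :: "(nat set \<Rightarrow> (nat \<times> nat) set \<Rightarrow> nat) \<Rightarrow> bool" where
  "admissible_rank rank \<longleftrightarrow> (\<forall>S. finite S \<longrightarrow> inj_on (rank S) {P. equiv S P})"

definition coding_set ::
    "(nat \<times> seqfun list \<Rightarrow> seqfun) \<Rightarrow> (seq list \<Rightarrow> nat) \<Rightarrow> nat \<times> seqfun list \<Rightarrow> nat set" where
  "coding_set star code v = {2 * code (initial_segment (star v) k) + 1 | k. True}"

definition prec :: "seqfun \<Rightarrow> nat \<Rightarrow> nat \<Rightarrow> bool" where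
  "prec h m m' \<longleftrightarrow> m < m' \<and> length (h m) = m \<and> length (h m') = m' \<and> strict_prefix (h m) (h m')"

definition terminal_set :: "seqfun \<Rightarrow> nat set \<Rightarrow> nat set" where
  "terminal_set h X = {m \<in> X. \<forall>m'\<in>X. \<not> prec h m m'}"

primrec chain :: "seqfun \<Rightarrow> nat set \<Rightarrow> nat \<Rightarrow> nat" where
  "chain h X 0 = (LEAST m. m \<in> X \<and> (\<forall>m'\<in>terminal_set h X. length (h m') < length (h m)))"
| "chain h X (Suc j) = (LEAST m. m \<in> X \<and> prec h (chain h X j) m)"

text \<open>The union of the finite sequences along the chain, viewed as graphs.\<close>

definition branch :: "seqfun \<Rightarrow> nat set \<Rightarrow> nat \<Rightarrow> nat" where
  "branch h X k = (THE v. \<exists>j. k < length (h (chain h X j)) \<and> v = h (chain h X j) ! k)"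

text \<open>In the following, \<open>X\<close> is the starting set \<open>X\<^sub>0\<close>, and \<open>n\<close> is \<open>length hs\<close>.\<close>

primrec stage :: "nat set \<Rightarrow> seqfun list \<Rightarrow> nat \<Rightarrow> nat set" where
  "stage X hs 0 = X"
| "stage X hs (Suc i) =
     (if infinite (terminal_set (hs ! i) (stage X hs i)) then terminal_set (hs ! i) (stage X hs i)
      else range (chain (hs ! i) (stage X hs i)))"

definition copyable :: "nat set \<Rightarrow> seqfun list \<Rightarrow> nat set" where
  "copyable X hs = {i. i < length hs \<and> infinite (terminal_set (hs ! i) (stage X hs i))}"

definition coherent :: "nat set \<Rightarrow> seqfun list \<Rightarrow> nat set" where
  "coherent X hs = {..<length hs} - copyable X hs"

definition coherent_branch :: "nat set \<Rightarrow> seqfun list \<Rightarrow> nat \<Rightarrow> nat \<Rightarrow> nat" where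
  "coherent_branch X hs i = branch (hs ! i) (stage X hs i)"

definition pattern :: "nat set \<Rightarrow> seqfun list \<Rightarrow> nat \<Rightarrow> (nat \<times> nat) set" where
  "pattern S hs k = {(i, j). i \<in> S \<and> j \<in> S \<and> (hs ! i) k = (hs ! j) k}"

text \<open>Two elements of \<open>X\<^sub>n\<close> are equivalent iff they have the same pattern, so that an equivalence class
  is the set of elements of \<open>X\<^sub>n\<close> with a given pattern.\<close>

definition pattern_class :: "nat set \<Rightarrow> seqfun list \<Rightarrow> (nat \<times> nat) set \<Rightarrow> nat set" where
  "pattern_class X hs P = {k \<in> stage X hs (length hs). pattern (copyable X hs) hs k = P}"

definition copy_domain ::
    "(nat set \<Rightarrow> (nat \<times> nat) set \<Rightarrow> nat) \<Rightarrow> nat set \<Rightarrow> seqfun list \<Rightarrow> nat set" where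
  "copy_domain rank X hs =
     pattern_class X hs (ARG_MIN (rank (copyable X hs)) P. infinite (pattern_class X hs P))"

text \<open>In the following, \<open>C\<close> is the domain of copying, \<open>S\<close> the set of copyable coordinates.\<close>

definition sim :: "nat set \<Rightarrow> nat set \<Rightarrow> seqfun list \<Rightarrow> (nat \<times> nat) set" where
  "sim C S hs = {(i, j). i \<in> S \<and> j \<in> S \<and> (\<forall>k\<in>C. (hs ! i) k = (hs ! j) k)}"

definition num_classes :: "nat set \<Rightarrow> nat set \<Rightarrow> seqfun list \<Rightarrow> nat" where
  "num_classes C S hs = card (S // sim C S hs)"

text \<open>The classes are numbered in the order of their least elements.\<close>

definition quotient_map :: "nat set \<Rightarrow> nat set \<Rightarrow> seqfun list \<Rightarrow> nat \<Rightarrow> nat" where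
  "quotient_map C S hs i = card {K \<in> S // sim C S hs. Min K < Min (sim C S hs `` {i})}"

definition free_coords ::
    "(nat \<times> seqfun list \<times> nat \<Rightarrow> nat \<Rightarrow> nat) \<Rightarrow> nat set \<Rightarrow> seqfun list \<Rightarrow> nat set" where
  "free_coords \<Phi> X hs = {c. c < length hs \<and>
     (\<forall>j\<in>coherent X hs. \<Phi> (length hs, hs, c) \<noteq> coherent_branch X hs j)}"

definition psi ::
    "(nat \<times> seqfun list \<times> nat \<Rightarrow> nat \<Rightarrow> nat) \<Rightarrow> nat set \<Rightarrow> seqfun list \<Rightarrow> nat \<Rightarrow> nat" where
  "psi \<Phi> X hs a = sorted_list_of_set (free_coords \<Phi> X hs) ! a"

definition e_dot ::
    "(nat \<times> seqfun list \<times> nat \<Rightarrow> nat \<Rightarrow> nat) \<Rightarrow> (nat \<times> seqfun list \<Rightarrow> seqfun) \<Rightarrow> (seq list \<Rightarrow> nat)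
      \<Rightarrow> (nat set \<Rightarrow> (nat \<times> nat) set \<Rightarrow> nat) \<Rightarrow> nat \<times> seqfun list \<times> nat \<Rightarrow> seqfun" where
  "e_dot \<Phi> star code rank = (\<lambda>(n, hs, i) k.
     let X = coding_set star code (n, hs);
         S = copyable X hs;
         C = copy_domain rank X hs;
         m = num_classes C S hs
     in if i \<in> psi \<Phi> X hs ` {..<m} \<and> k \<in> C
        then (hs ! (SOME j. j \<in> S \<and> psi \<Phi> X hs (quotient_map C S hs j) = i)) k
        else e_map (\<Phi> (n, hs, i)) k)"

definition E_family ::
    "(nat \<times> seqfun list \<times> nat \<Rightarrow> nat \<Rightarrow> nat) \<Rightarrow> (nat \<times> seqfun list \<Rightarrow> seqfun) \<Rightarrow> (seq list \<Rightarrow> nat)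
      \<Rightarrow> (nat set \<Rightarrow> (nat \<times> nat) set \<Rightarrow> nat) \<Rightarrow> seqfun set" where
  "E_family \<Phi> star code rank = e_dot \<Phi> star code rank ` Requirements"

end

theory Submission
  imports Defs
begin

text \<open>
  Write \<open>E\<close> for the family. For an eventually different family, an infinite set \<open>A\<close> lies outside the
  ideal of the \<open>n\<close>-th power iff every \<open>n\<close>-tuple of functions agrees, in all coordinates at once and
  at infinitely many points of \<open>A\<close>, with some \<open>n\<close>-tuple of members of the family
  (\<open>ideal0_family_power\<close>, \<open>ideal0_eq_power_1\<close>). This reduces the ideals to \<open>power_maximal_on\<close>. The
  condition for \<open>n + 1\<close> implies the one for \<open>n\<close>, by padding a tuple with an arbitrary coordinate and
  forgetting it afterwards; hence the ideals increase.

  The set that separates the \<open>n\<close>-th ideal from the next one is the union \<open>A\<close> of the sets \<open>B(k, h)\<close>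
  over all \<open>k \<le> n\<close> and all vectors \<open>h\<close> of length \<open>k\<close>. An \<open>n\<close>-tuple \<open>h\<close> of functions is itself a
  vector with \<open>B(n, h) \<subseteq> A\<close>, and the construction makes \<open>E\<close> agree with each \<open>h\<^sub>j\<close> at almost all
  points of the infinite set \<open>C(n, h) \<subseteq> B(n, h)\<close> (\<open>coordinate_met\<close>): a copyable coordinate has been
  copied, and a coherent one traces out the initial segments of a function, which the member of \<open>E\<close>
  with that value of \<open>\<Phi>\<close> also takes. So \<open>A\<close> is outside the \<open>n\<close>-th ideal.

  For \<open>n + 1\<close>, take functions \<open>g\<^sub>0, \<dots>, g\<^sub>n\<close> with \<open>g\<^sub>i(a)\<close> of length \<open>a + 1 + i\<close>. Outside
  \<open>C(v)\<close>, a member of \<open>E\<close> indexed by \<open>v\<close> has a value of length \<open>a\<close> at \<open>a\<close>, so it can meet \<open>g\<^sub>i\<close>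
  only on \<open>B(v)\<close>. The sets \<open>B(v)\<close> are almost disjoint, hence members meeting \<open>g\<^sub>0, \<dots>, g\<^sub>n\<close>
  simultaneously at infinitely many points of \<open>A\<close> all have the same index vector \<open>v\<close>. Its length is
  at most \<open>n\<close>, since longer vectors have \<open>B(v)\<close> almost disjoint from \<open>A\<close>. Only \<open>n\<close> members of \<open>E\<close> are
  indexed by \<open>v\<close>, so two of the \<open>n + 1\<close> members coincide, although the \<open>g\<^sub>i\<close> have distinct values
  everywhere. So \<open>A\<close> is in the ideal for \<open>n + 1\<close>.
\<close>

section \<open>Powers of families and their ideals\<close>

definition power_maximal_on :: "(nat \<Rightarrow> 'b) set \<Rightarrow> nat \<Rightarrow> nat set \<Rightarrow> bool" where
  "power_maximal_on F n A \<longleftrightarrow> (\<forall>gs. length gs = n \<longrightarrow>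
     (\<exists>fs\<in>set_power F n. infinite {a \<in> A. fun_product fs a = fun_product gs a}))"

text \<open>An \<open>n\<close>-tuple is padded with an arbitrary function, and the coordinate meeting that function is
  forgotten.\<close>

lemma power_maximal_on_Suc_imp:
  assumes "power_maximal_on F (Suc n) A"
  shows "power_maximal_on F n A"
  unfolding power_maximal_on_def
proof (intro allI impI)
  fix gs :: "(nat \<Rightarrow> 'a) list"
  assume len: "length gs = n"
  obtain fs where fs: "fs \<in> set_power F (Suc n)"
    and inf: "infinite {a \<in> A. fun_product fs a = fun_product (gs @ [undefined]) a}"
    using assms len unfolding power_maximal_on_def by force
  have "take n fs \<in> set_power F n"
    using fs set_take_subset[of n fs] by (auto simp: set_power_def)
  moreover have "{a \<in> A. fun_product fs a = fun_product (gs @ [undefined]) a}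
      \<subseteq> {a \<in> A. fun_product (take n fs) a = fun_product gs a}"
  proof -
    have "fun_product (take n fs) a = fun_product gs a"
      if "fun_product fs a = fun_product (gs @ [undefined]) a" for a
      using arg_cong[OF that, of "take n"] len by (simp add: fun_product_def take_map)
    then show ?thesis by blast
  qed
  ultimately show "\<exists>fs\<in>set_power F n. infinite {a \<in> A. fun_product fs a = fun_product gs a}"
    using inf infinite_super by blast
qed

text \<open>If no member of the family meets \<open>g\<close> infinitely often, then \<open>g\<close> can be added. Conversely, a
  function in a larger eventually different family that is met infinitely often by some \<open>f \<in> F\<close>
  must coincide with \<open>f\<close> on \<open>A\<close>.\<close>

lemma med_family_restrict_iff:
  assumes inf: "infinite A" and F: "F \<subseteq> A \<rightarrow> B" and ed: "pairwise (eventually_different A) F"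
  shows "med_family A B ((\<lambda>f. restrict f A) ` F) \<longleftrightarrow>
    (\<forall>g \<in> A \<rightarrow> B. \<exists>f\<in>F. infinite {a \<in> A. f a = g a})"
proof -
  let ?R = "(\<lambda>f. restrict f A) ` F"
  have R: "ed_family A B ?R"
    unfolding ed_family_def
  proof (intro conjI pairwiseI)
    show "?R \<subseteq> A \<rightarrow>\<^sub>E B" using F unfolding image_subset_iff restrict_PiE by blast
    fix x y assume "x \<in> ?R" "y \<in> ?R" "x \<noteq> y"
    then obtain f g where "f \<in> F" "g \<in> F" "f \<noteq> g" "x = restrict f A" "y = restrict g A" by blast
    moreover from this have "{a \<in> A. x a = y a} = {a \<in> A. f a = g a}" by auto
    ultimately show "eventually_different A x y"
      using ed by (simp add: pairwise_def eventually_different_def)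
  qed
  show ?thesis
  proof (intro iffI ballI)
    fix g assume med: "med_family A B ?R" and g: "g \<in> A \<rightarrow> B"
    show "\<exists>f\<in>F. infinite {a \<in> A. f a = g a}"
    proof (rule ccontr)
      assume no: "\<not> (\<exists>f\<in>F. infinite {a \<in> A. f a = g a})"
      let ?g = "restrict g A"
      have "eventually_different A ?g (restrict f A) \<and> eventually_different A (restrict f A) ?g"
        if "f \<in> F" for f
      proof -
        have "{a \<in> A. ?g a = restrict f A a} = {a \<in> A. f a = g a}"
          "{a \<in> A. restrict f A a = ?g a} = {a \<in> A. f a = g a}" by auto
        then show ?thesis using no that by (simp add: eventually_different_def)
      qed
      then have "ed_family A B (insert ?g ?R)"
        using R g unfolding ed_family_def pairwise_insert by (auto simp del: restrict_apply)
      then have "?g \<in> ?R"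
        using med unfolding med_family_def by blast
      then obtain f where f: "f \<in> F" "restrict f A = ?g" by force
      have "f a = g a" if "a \<in> A" for a using fun_cong[OF f(2), of a] that by simp
      then have "{a \<in> A. f a = g a} = A" by blast
      then show False using f no inf by auto
    qed
  next
    assume hit: "\<forall>g \<in> A \<rightarrow> B. \<exists>f\<in>F. infinite {a \<in> A. f a = g a}"
    have "G \<subseteq> ?R" if G: "ed_family A B G" "?R \<subseteq> G" for G
    proof
      fix g assume g: "g \<in> G"
      then have "g \<in> A \<rightarrow> B" using G by (auto simp: ed_family_def)
      then obtain f where f: "f \<in> F" "infinite {a \<in> A. f a = g a}" using hit by blast
      moreover have "{a \<in> A. restrict f A a = g a} = {a \<in> A. f a = g a}" by auto
      ultimately have "\<not> eventually_different A (restrict f A) g"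
        by (simp only: eventually_different_def not_False_eq_True)
      moreover have "restrict f A \<in> G" using f G by blast
      ultimately have "restrict f A = g"
        using G(1) g by (auto simp: ed_family_def pairwise_def)
      then show "g \<in> ?R" using f by blast
    qed
    then show "med_family A B ?R" using R by (auto simp: med_family_def)
  qed
qed

lemma family_power_pairwise:
  assumes ed: "pairwise (eventually_different A) F"
  shows "pairwise (eventually_different A) (family_power F n)"
proof (rule pairwiseI)
  fix x y assume "x \<in> family_power F n" "y \<in> family_power F n" "x \<noteq> y"
  then obtain fs gs where *: "length fs = n" "set fs \<subseteq> F" "length gs = n" "set gs \<subseteq> F"
    "x = fun_product fs" "y = fun_product gs" "fs \<noteq> gs"
    by (auto simp: family_power_def set_power_def)
  \<comment> \<open>Products that agree at a point agree there in every coordinate, so one coordinate where the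
    factors are different functions suffices.\<close>
  then obtain i where i: "i < n" "fs ! i \<noteq> gs ! i" by (metis nth_equalityI)
  have "{a \<in> A. x a = y a} \<subseteq> {a \<in> A. (fs ! i) a = (gs ! i) a}"
  proof
    fix a assume "a \<in> {a \<in> A. x a = y a}"
    then have "a \<in> A" "map (\<lambda>f. f a) fs ! i = map (\<lambda>f. f a) gs ! i"
      using * by (auto simp: fun_product_def)
    then show "a \<in> {a \<in> A. (fs ! i) a = (gs ! i) a}" using * i by simp
  qed
  moreover have "eventually_different A (fs ! i) (gs ! i)"
    using ed * i by (metis nth_mem pairwise_def subsetD)
  ultimately show "eventually_different A x y"
    unfolding eventually_different_def using finite_subset by blast
qed

lemma pairwise_eventually_different_restrict:
  assumes "pairwise (eventually_different UNIV) F"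
  shows "pairwise (eventually_different A) F"
  using assms unfolding pairwise_def eventually_different_def
  by (auto elim!: ballE rev_finite_subset)

lemma ideal0_family_power:
  assumes ed: "pairwise (eventually_different UNIV) F"
  shows "ideal0 (set_power UNIV n) (family_power F n) = {A. infinite A \<longrightarrow> \<not> power_maximal_on F n A}"
proof -
  have "med_family A (set_power UNIV n) ((\<lambda>f. restrict f A) ` family_power F n)
      \<longleftrightarrow> power_maximal_on F n A" if inf: "infinite A" for A
  proof -
    have sub: "family_power F n \<subseteq> A \<rightarrow> set_power UNIV n"
      by (auto simp: family_power_def fun_product_def set_power_def)
    have "(\<forall>g \<in> A \<rightarrow> set_power UNIV n. \<exists>f\<in>family_power F n. infinite {a \<in> A. f a = g a})
       \<longleftrightarrow> power_maximal_on F n A" (is "?L \<longleftrightarrow> _")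
    proof
      assume L: ?L
      show "power_maximal_on F n A"
        unfolding power_maximal_on_def
      proof (intro allI impI)
        fix gs :: "(nat \<Rightarrow> 'a) list" assume "length gs = n"
        then have "fun_product gs \<in> A \<rightarrow> set_power UNIV n"
          by (auto simp: fun_product_def set_power_def)
        then show "\<exists>fs\<in>set_power F n. infinite {a \<in> A. fun_product fs a = fun_product gs a}"
          using L by (auto simp: family_power_def)
      qed
    next
      assume R: "power_maximal_on F n A"
      show ?L
      proof
        fix g assume g: "g \<in> A \<rightarrow> set_power (UNIV :: 'a set) n"
        define gs where "gs = map (\<lambda>i a. g a ! i) [0..<n]"
        have eq: "fun_product gs a = g a" if "a \<in> A" for a
        proof (rule nth_equalityI)
          have "length (g a) = n" using g that by (auto simp: set_power_def)
          then show "length (fun_product gs a) = length (g a)"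
            by (simp add: fun_product_def gs_def)
        qed (simp add: fun_product_def gs_def)
        obtain fs where "fs \<in> set_power F n" "infinite {a \<in> A. fun_product fs a = fun_product gs a}"
          using R unfolding power_maximal_on_def by (metis gs_def length_map length_upt minus_nat.diff_0)
        moreover have "{a \<in> A. fun_product fs a = fun_product gs a} = {a \<in> A. fun_product fs a = g a}"
          using eq by auto
        ultimately show "\<exists>f\<in>family_power F n. infinite {a \<in> A. f a = g a}"
          by (auto simp: family_power_def)
      qed
    qed
    then show ?thesis
      using med_family_restrict_iff[OF inf sub
          family_power_pairwise[OF pairwise_eventually_different_restrict[OF ed]]]
      by simp
  qed
  then show ?thesis by (auto simp: ideal0_def)
qed

lemma ideal0_eq_power_1:
  assumes ed: "pairwise (eventually_different UNIV) F"
  shows "ideal0 UNIV F = {A. infinite A \<longrightarrow> \<not> power_maximal_on F 1 A}"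
proof -
  have "med_family A UNIV ((\<lambda>f. restrict f A) ` F) \<longleftrightarrow> power_maximal_on F 1 A"
    if inf: "infinite A" for A
  proof -
    have "(\<forall>g. \<exists>f\<in>F. infinite {a \<in> A. f a = g a}) \<longleftrightarrow> power_maximal_on F 1 A"
    proof
      assume L: "\<forall>g. \<exists>f\<in>F. infinite {a \<in> A. f a = g a}"
      show "power_maximal_on F 1 A"
        unfolding power_maximal_on_def
      proof (intro allI impI)
        fix gs :: "(nat \<Rightarrow> 'a) list" assume "length gs = 1"
        then obtain g where g: "gs = [g]" by (cases gs) auto
        obtain f where "f \<in> F" "infinite {a \<in> A. f a = g a}" using L by blast
        then show "\<exists>fs\<in>set_power F 1. infinite {a \<in> A. fun_product fs a = fun_product gs a}"
          using g by (intro bexI[of _ "[f]"]) (auto simp: fun_product_def set_power_def)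
      qed
    next
      assume R: "power_maximal_on F 1 A"
      show "\<forall>g. \<exists>f\<in>F. infinite {a \<in> A. f a = g a}"
      proof
        fix g :: "nat \<Rightarrow> 'a"
        obtain fs where fs: "fs \<in> set_power F 1"
          "infinite {a \<in> A. fun_product fs a = fun_product [g] a}"
          using R unfolding power_maximal_on_def by (metis One_nat_def length_Cons list.size(3))
        then obtain f where "fs = [f]" "f \<in> F" by (cases fs) (auto simp: set_power_def)
        then show "\<exists>f\<in>F. infinite {a \<in> A. f a = g a}" using fs by (auto simp: fun_product_def)
      qed
    qed
    then show ?thesis
      using med_family_restrict_iff[OF inf _ pairwise_eventually_different_restrict[OF ed], of UNIV]
      by simp
  qed
  then show ?thesis by (auto simp: ideal0_def)
qed

section \<open>Initial segments, terminal points and chains\<close>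

lemma length_e_map [simp]: "length (e_map f k) = k"
  by (simp add: e_map_def initial_segment_def)

lemma initial_segment_eq_imp:
  assumes "initial_segment f k = initial_segment g l"
  shows "k = l" "i < k \<Longrightarrow> f i = g i"
proof -
  show kl: "k = l" using arg_cong[OF assms, of length] by (simp add: initial_segment_def)
  show "f i = g i" if "i < k"
    using arg_cong[OF assms, of "\<lambda>s. s ! i"] that kl by (simp add: initial_segment_def)
qed

lemma finite_e_map_agreement:
  assumes "f \<noteq> g"
  shows "finite {k. e_map f k = e_map g k}"
proof -
  obtain i where "f i \<noteq> g i" using assms by blast
  then have "{k. e_map f k = e_map g k} \<subseteq> {..i}"
    using initial_segment_eq_imp(2)[of f _ g _ i] by (force simp: e_map_def)
  then show ?thesis using finite_subset by blast
qed

lemma strict_prefix_e_map: "k < l \<Longrightarrow> strict_prefix (e_map f k) (e_map f l)"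
proof -
  assume "k < l"
  then obtain d where "l = k + d" by (metis less_imp_add_positive)
  then have "e_map f l = e_map f k @ map f [k..<l]"
    unfolding e_map_def initial_segment_def by (simp add: upt_add_eq_append[OF le0, of k d])
  then show ?thesis using \<open>k < l\<close> by (auto simp: strict_prefix_def)
qed

text \<open>At two points where \<open>h\<close> agrees with \<open>e_map f\<close>, the values are initial segments of the same
  function with the right lengths, so the smaller point precedes the larger one and is not terminal.
  Hence there is at most one such terminal point. This is why copying on terminal sets keeps the
  family eventually different.\<close>

lemma finite_terminal_e_map_agreement:
  "finite {k \<in> terminal_set h X. h k = e_map f k}" (is "finite ?Z")
proof -
  have "k = l" if "k \<in> ?Z" "l \<in> ?Z" for k l
  proof -
    have "\<not> k < l" if "k \<in> ?Z" "l \<in> ?Z" for k l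
      using that strict_prefix_e_map[of k l f] by (auto simp: terminal_set_def prec_def)
    then show ?thesis using that by (meson linorder_neqE_nat)
  qed
  then have "?Z \<subseteq> {k}" if "k \<in> ?Z" for k using that by blast
  then show ?thesis by (metis (no_types, lifting) equals0I finite.emptyI finite_insert finite_subset)
qed

context
  fixes h :: seqfun and X :: "nat set"
  assumes inf: "infinite X" and fin: "finite (terminal_set h X)"
begin

text \<open>The two facts are proved together: each chain element has a value longer than all values at
  terminal points, hence is not terminal, hence has a successor, whose value is longer still.\<close>

lemma chain_in:
  "chain h X j \<in> X \<and> (\<forall>m\<in>terminal_set h X. length (h m) < length (h (chain h X j)))"
  and prec_chain_Suc: "prec h (chain h X j) (chain h X (Suc j))"
proof -
  let ?long = "\<lambda>m. m \<in> X \<and> (\<forall>m'\<in>terminal_set h X. length (h m') < length (h m))"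
  have step: "chain h X (Suc j) \<in> X \<and> prec h (chain h X j) (chain h X (Suc j))"
    if "?long (chain h X j)" for j
  proof -
    have "chain h X j \<notin> terminal_set h X" using that by blast
    then have "\<exists>m. m \<in> X \<and> prec h (chain h X j) m" using that by (auto simp: terminal_set_def)
    from LeastI_ex[OF this] show ?thesis by simp
  qed
  have long: "?long (chain h X j)" for j
  proof (induction j)
    case 0
    \<comment> \<open>A nonterminal point \<open>m\<close> has \<open>length (h m) = m\<close>, so large nonterminal points have long
      values.\<close>
    have "infinite (X - terminal_set h X)" using inf fin by simp
    then obtain m where m: "m \<in> X - terminal_set h X"
        "Max ((\<lambda>m. length (h m)) ` terminal_set h X) < m"
      by (metis finite_nat_set_iff_bounded_le not_le)
    have "length (h m) = m" using m(1) by (auto simp: terminal_set_def prec_def)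
    moreover have "length (h m') \<le> Max ((\<lambda>m. length (h m)) ` terminal_set h X)"
      if "m' \<in> terminal_set h X" for m'
      using fin that by simp
    ultimately have "?long m" using m by fastforce
    then have "\<exists>m. ?long m" by blast
    from LeastI_ex[OF this] show ?case by simp
  next
    case (Suc j)
    then show ?case using step[OF Suc] by (force simp: prec_def simp del: chain.simps)
  qed
  show "?long (chain h X j)" by (rule long)
  show "prec h (chain h X j) (chain h X (Suc j))" using step[OF long] by blast
qed

lemma strict_mono_chain: "strict_mono (chain h X)"
  using prec_chain_Suc by (simp add: strict_mono_Suc_iff prec_def del: chain.simps)

lemma length_chain: "length (h (chain h X j)) = chain h X j"
  using prec_chain_Suc[of j] by (simp add: prec_def del: chain.simps)

lemma prefix_chain: "i \<le> j \<Longrightarrow> prefix (h (chain h X i)) (h (chain h X j))"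
proof (induction rule: dec_induct)
  case (step j)
  then show ?case
    using prec_chain_Suc[of j] prefix_order.trans
    by (auto simp: prec_def strict_prefix_def simp del: chain.simps)
qed simp

lemma e_map_branch_chain: "e_map (branch h X) (chain h X j) = h (chain h X j)"
proof (rule nth_equalityI)
  fix k assume "k < length (e_map (branch h X) (chain h X j))"
  then have k: "k < chain h X j" by simp
  have "branch h X k = h (chain h X j) ! k"
    unfolding branch_def
  proof (rule the_equality)
    show "\<exists>i. k < length (h (chain h X i)) \<and> h (chain h X j) ! k = h (chain h X i) ! k"
      using k length_chain by auto
    fix v assume "\<exists>i. k < length (h (chain h X i)) \<and> v = h (chain h X i) ! k"
    then obtain i where i: "k < length (h (chain h X i))" "v = h (chain h X i) ! k" by blast
    have "prefix (h (chain h X i)) (h (chain h X j)) \<or> prefix (h (chain h X j)) (h (chain h X i))"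
      using prefix_chain nat_le_linear by blast
    then show "v = h (chain h X j) ! k"
      using i k length_chain[of j] by (auto simp: prefix_def nth_append)
  qed
  then show "e_map (branch h X) (chain h X j) ! k = h (chain h X j) ! k"
    using k by (simp add: e_map_def initial_segment_def)
qed (simp add: length_chain)

lemma range_chain: "range (chain h X) \<subseteq> X" "infinite (range (chain h X))"
  using chain_in strict_mono_imp_inj_on[OF strict_mono_chain] by (auto dest: finite_imageD)

end

section \<open>Copyable and coherent coordinates\<close>

lemma finite_copyable [simp]: "finite (copyable X hs)"
  by (simp add: copyable_def)

lemma infinite_stage: "infinite X \<Longrightarrow> infinite (stage X hs i)"
  by (induction i) (auto simp: range_chain)

lemma stage_Suc_subset: "infinite X \<Longrightarrow> stage X hs (Suc i) \<subseteq> stage X hs i"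
  using range_chain(1)[OF infinite_stage] by (auto simp: terminal_set_def)

lemma stage_antimono: "infinite X \<Longrightarrow> i \<le> j \<Longrightarrow> stage X hs j \<subseteq> stage X hs i"
  by (rule lift_Suc_antimono_le[where f = "stage X hs"]) (rule stage_Suc_subset)

lemma copyable_agreement_finite:
  assumes "infinite X" "j \<in> copyable X hs"
  shows "finite {k \<in> stage X hs (length hs). (hs ! j) k = e_map f k}"
proof -
  have j: "j < length hs" "infinite (terminal_set (hs ! j) (stage X hs j))"
    using assms by (auto simp: copyable_def)
  then have "stage X hs (length hs) \<subseteq> terminal_set (hs ! j) (stage X hs j)"
    using stage_antimono[OF assms(1), of "Suc j" "length hs" hs] by simp
  then have "{k \<in> stage X hs (length hs). (hs ! j) k = e_map f k}
      \<subseteq> {k \<in> terminal_set (hs ! j) (stage X hs j). (hs ! j) k = e_map f k}" by blast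
  then show ?thesis using finite_terminal_e_map_agreement finite_subset by blast
qed

lemma coherent_eq_e_map:
  assumes "infinite X" "j \<in> coherent X hs" "k \<in> stage X hs (length hs)"
  shows "(hs ! j) k = e_map (coherent_branch X hs j) k"
proof -
  have j: "j < length hs" "finite (terminal_set (hs ! j) (stage X hs j))"
    using assms by (auto simp: coherent_def copyable_def)
  then have "k \<in> range (chain (hs ! j) (stage X hs j))"
    using stage_antimono[OF assms(1), of "Suc j" "length hs" hs] assms(3) by auto
  then show ?thesis
    using e_map_branch_chain[OF infinite_stage[OF assms(1)] j(2)]
    by (auto simp: coherent_branch_def)
qed

lemma copy_domain_subset: "infinite X \<Longrightarrow> copy_domain rank X hs \<subseteq> stage X hs (length hs)"
  by (auto simp: copy_domain_def pattern_class_def)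

text \<open>There are only finitely many patterns, so one of the classes into which they split the
  infinite last stage is infinite.\<close>

lemma infinite_copy_domain:
  assumes "infinite X"
  shows "infinite (copy_domain rank X hs)"
proof -
  let ?S = "copyable X hs"
  have "finite (Pow (?S \<times> ?S))" by simp
  moreover have "stage X hs (length hs) \<subseteq> (\<Union>P\<in>Pow (?S \<times> ?S). pattern_class X hs P)"
  proof
    fix k assume "k \<in> stage X hs (length hs)"
    then have "k \<in> pattern_class X hs (pattern ?S hs k)" by (simp add: pattern_class_def)
    moreover have "pattern ?S hs k \<in> Pow (?S \<times> ?S)" by (auto simp: pattern_def)
    ultimately show "k \<in> (\<Union>P\<in>Pow (?S \<times> ?S). pattern_class X hs P)" by (rule UN_I[rotated])
  qed
  then have "infinite (\<Union>P\<in>Pow (?S \<times> ?S). pattern_class X hs P)"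
    using infinite_stage[OF assms] finite_subset by blast
  ultimately obtain P where P: "infinite (pattern_class X hs P)" by blast
  show ?thesis
    unfolding copy_domain_def
    by (rule arg_min_nat_lemma[where P = "\<lambda>P. infinite (pattern_class X hs P)", OF P, THEN conjunct1])
qed

lemma copy_domain_uniform:
  assumes "i \<in> copyable X hs" "j \<in> copyable X hs"
    "k \<in> copy_domain rank X hs" "l \<in> copy_domain rank X hs" "(hs ! i) k = (hs ! j) k"
  shows "(hs ! i) l = (hs ! j) l"
proof -
  have "pattern (copyable X hs) hs k = pattern (copyable X hs) hs l"
    using assms by (simp add: copy_domain_def pattern_class_def)
  then show ?thesis using assms by (auto simp: pattern_def)
qed

text \<open>Numbering the elements of a finite set by the number of elements of smaller rank; this is how
  \<open>quotient_map\<close> numbers the classes, ranked by their least elements.\<close>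

lemma bij_betw_card_less:
  fixes f :: "'a \<Rightarrow> nat"
  assumes fin: "finite Q" and inj: "inj_on f Q"
  shows "bij_betw (\<lambda>x. card {y \<in> Q. f y < f x}) Q {..<card Q}" (is "bij_betw ?r _ _")
proof -
  have less: "?r x < ?r y" if "x \<in> Q" "f x < f y" for x y
    using that fin by (intro psubset_card_mono) auto
  have "inj_on ?r Q"
  proof (rule inj_onI, rule ccontr)
    fix x y assume xy: "x \<in> Q" "y \<in> Q" "?r x = ?r y" "x \<noteq> y"
    then have "f x \<noteq> f y" using inj by (auto dest: inj_onD)
    then show False using less[of x y] less[of y x] xy by linarith
  qed
  moreover have "?r ` Q \<subseteq> {..<card Q}"
    using fin by (auto intro!: psubset_card_mono)
  ultimately have "?r ` Q = {..<card Q}"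
    by (intro card_subset_eq) (simp_all add: card_image)
  with \<open>inj_on ?r Q\<close> show ?thesis by (simp add: bij_betw_def)
qed

lemma equiv_sim: "equiv S (sim C S hs)"
  by (rule equivI) (auto simp: refl_on_def sym_def trans_def sim_def)

context
  fixes C S :: "nat set" and hs :: "seqfun list"
  assumes fin: "finite S"
begin

lemma quotient_map_eq_iff:
  "i \<in> S \<Longrightarrow> j \<in> S \<Longrightarrow>
    quotient_map C S hs i = quotient_map C S hs j \<longleftrightarrow> (i, j) \<in> sim C S hs"
  and image_quotient_map: "quotient_map C S hs ` S = {..<num_classes C S hs}"
proof -
  let ?R = "sim C S hs"
  let ?Q = "S // ?R"
  let ?r = "\<lambda>K. card {K' \<in> ?Q. Min K' < Min K}"
  have finQ: "finite ?Q" using fin by (rule finite_quotient) (auto simp: sim_def)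
  have "inj_on Min ?Q"
  proof (rule inj_onI)
    fix K L assume KL: "K \<in> ?Q" "L \<in> ?Q" "Min K = Min L"
    have "Min K \<in> K" if "K \<in> ?Q" for K
      using that fin in_quotient_imp_subset[OF equiv_sim] in_quotient_imp_non_empty[OF equiv_sim]
      by (meson Min_in finite_subset)
    then have "Min K \<in> K" "Min L \<in> L" using KL by blast+
    then show "K = L"
      using KL quotient_disj[OF equiv_sim, of K S C hs L] by auto
  qed
  from bij_betw_card_less[OF finQ this] have bij: "bij_betw ?r ?Q {..<card ?Q}" .
  have q: "quotient_map C S hs = (\<lambda>i. ?r (?R `` {i}))" by (simp add: quotient_map_def fun_eq_iff)
  show "quotient_map C S hs i = quotient_map C S hs j \<longleftrightarrow> (i, j) \<in> ?R"
    if ij: "i \<in> S" "j \<in> S"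
  proof -
    have "quotient_map C S hs i = quotient_map C S hs j \<longleftrightarrow> ?R `` {i} = ?R `` {j}"
      unfolding q using bij ij by (intro inj_on_eq_iff[of ?r]) (auto simp: bij_betw_def quotientI)
    also have "\<dots> \<longleftrightarrow> (i, j) \<in> ?R" using eq_equiv_class_iff[OF equiv_sim ij] .
    finally show ?thesis .
  qed
  have "quotient_map C S hs ` S = ?r ` ?Q"
    unfolding q by (auto simp: quotient_def image_iff)
  then show "quotient_map C S hs ` S = {..<num_classes C S hs}"
    using bij by (simp add: bij_betw_def num_classes_def)
qed

end

lemma num_classes_le: "finite S \<Longrightarrow> num_classes C S hs \<le> card S"
  using image_quotient_map[of S C hs] by (metis card_image_le card_lessThan)

section \<open>The family\<close>

locale ed_construction =
  fixes \<Phi> :: "nat \<times> seqfun list \<times> nat \<Rightarrow> nat \<Rightarrow> nat"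
    and star :: "nat \<times> seqfun list \<Rightarrow> seqfun"
    and code :: "seq list \<Rightarrow> nat"
    and rank :: "nat set \<Rightarrow> (nat \<times> nat) set \<Rightarrow> nat"
  assumes bij_Phi: "bij_betw \<Phi> Requirements UNIV"
    and inj_star: "inj_on star Vectors"
    and star_0: "\<And>v v'. v \<in> Vectors \<Longrightarrow> v' \<in> Vectors \<Longrightarrow> star v 0 = star v' 0 \<Longrightarrow> fst v = fst v'"
    and inj_code: "inj code"
begin

abbreviation "B \<equiv> coding_set star code"
abbreviation "ed \<equiv> e_dot \<Phi> star code rank"
abbreviation "C v \<equiv> copy_domain rank (B v) (snd v)"
abbreviation "S v \<equiv> copyable (B v) (snd v)"

lemma infinite_B: "infinite (B v)"
proof -
  let ?f = "\<lambda>k. 2 * code (initial_segment (star v) k) + 1"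
  have "inj ?f"
    using inj_code initial_segment_eq_imp(1) by (fastforce simp: inj_on_def)
  moreover have "B v = range ?f" by (auto simp: coding_set_def)
  ultimately show ?thesis by (simp add: finite_image_iff)
qed

text \<open>A common element of \<open>B v\<close> and \<open>B v'\<close> codes a common initial segment of \<open>star v\<close> and
  \<open>star v'\<close>, which must end before the first difference.\<close>

lemma B_Int_B:
  assumes "star v i \<noteq> star v' i"
  shows "B v \<inter> B v' \<subseteq> (\<lambda>k. 2 * code (initial_segment (star v) k) + 1) ` {..i}"
proof
  fix x assume "x \<in> B v \<inter> B v'"
  then obtain k l where x: "x = 2 * code (initial_segment (star v) k) + 1"
    "x = 2 * code (initial_segment (star v') l) + 1" unfolding coding_set_def by blast
  then have "initial_segment (star v) k = initial_segment (star v') l"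
    using inj_code by (simp add: inj_eq)
  then have "k \<le> i" using initial_segment_eq_imp(2) assms by (metis not_le)
  then show "x \<in> (\<lambda>k. 2 * code (initial_segment (star v) k) + 1) ` {..i}" using x by blast
qed

lemma finite_B_Int_B:
  assumes "v \<in> Vectors" "v' \<in> Vectors" "v \<noteq> v'"
  shows "finite (B v \<inter> B v')"
proof -
  have "star v \<noteq> star v'" using assms inj_star by (auto dest: inj_onD)
  then obtain i where "star v i \<noteq> star v' i" by blast
  from finite_subset[OF B_Int_B[OF this]] show ?thesis by simp
qed

lemma C_subset_B: "C v \<subseteq> B v"
  using subset_trans[OF copy_domain_subset[OF infinite_B] stage_antimono[OF infinite_B le0]]
  by simp

lemma infinite_C: "infinite (C v)"
  by (simp add: infinite_copy_domain infinite_B)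

text \<open>The coordinates that the construction redefines on \<open>C v\<close>; all others keep \<open>e_map\<close> of \<open>\<Phi>\<close>.\<close>

definition copied :: "nat \<times> seqfun list \<Rightarrow> nat set" where
  "copied v = psi \<Phi> (B v) (snd v) ` {..<num_classes (C v) (S v) (snd v)}"

text \<open>The selection of coordinates for copying succeeds: by injectivity of \<open>\<Phi>\<close>, each coherent
  coordinate makes at most one coordinate unavailable, which leaves at least as many as there are
  copyable coordinates, and these are at least as many as there are classes.\<close>

lemma psi_free:
  assumes v: "(n, hs) \<in> Vectors"
  shows "psi \<Phi> (B (n, hs)) hs ` {..<num_classes (C (n, hs)) (S (n, hs)) hs}
      \<subseteq> free_coords \<Phi> (B (n, hs)) hs"
    and "inj_on (psi \<Phi> (B (n, hs)) hs) {..<num_classes (C (n, hs)) (S (n, hs)) hs}"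
proof -
  let ?X = "B (n, hs)"
  let ?F = "free_coords \<Phi> ?X hs" and ?m = "num_classes (C (n, hs)) (S (n, hs)) hs"
  have len: "length hs = n" using v by (simp add: Vectors_def)
  have finF: "finite ?F" by (simp add: free_coords_def)
  have "inj_on (\<lambda>c. \<Phi> (n, hs, c)) ({..<n} - ?F)"
    using bij_Phi v by (auto simp: bij_betw_def inj_on_def Requirements_def)
  moreover have "(\<lambda>c. \<Phi> (n, hs, c)) ` ({..<n} - ?F) \<subseteq> coherent_branch ?X hs ` coherent ?X hs"
    using len by (auto simp: free_coords_def)
  moreover have fincoh: "finite (coherent ?X hs)" by (simp add: coherent_def)
  ultimately have "card ({..<n} - ?F) \<le> card (coherent ?X hs)"
    by (meson card_image_le card_inj_on_le finite_imageI order_trans)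
  moreover have "card (coherent ?X hs) = n - card (copyable ?X hs)"
    using len by (simp add: coherent_def card_Diff_subset copyable_def subset_eq)
  moreover have "card ({..<n} - ?F) = n - card ?F"
    using finF len by (subst card_Diff_subset) (auto simp: free_coords_def)
  moreover have "card ?F \<le> n" "card (copyable ?X hs) \<le> n"
    using len by (auto intro!: subset_eq_atLeast0_lessThan_card simp: free_coords_def copyable_def)
  ultimately have "card (copyable ?X hs) \<le> card ?F" by linarith
  then have m: "?m \<le> length (sorted_list_of_set ?F)"
    using num_classes_le[OF finite_copyable[of "B (n, hs)" hs], of "C (n, hs)" hs] by simp
  show "psi \<Phi> ?X hs ` {..<?m} \<subseteq> ?F"
  proof (rule image_subsetI)
    fix a assume "a \<in> {..<?m}"
    then have "psi \<Phi> ?X hs a \<in> set (sorted_list_of_set ?F)"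
      unfolding psi_def using m by (intro nth_mem) simp
    then show "psi \<Phi> ?X hs a \<in> ?F" using finF by simp
  qed
  show "inj_on (psi \<Phi> ?X hs) {..<?m}"
    using m by (auto simp: psi_def inj_on_def nth_eq_iff_index_eq)
qed

lemma ed_not_copying:
  assumes "i \<notin> copied (n, hs) \<or> k \<notin> C (n, hs)"
  shows "ed (n, hs, i) k = e_map (\<Phi> (n, hs, i)) k"
  using assms by (auto simp: e_dot_def Let_def copied_def)

lemma ed_copied:
  assumes v: "(n, hs) \<in> Vectors" and i: "i \<in> copied (n, hs)"
  obtains j where "j \<in> S (n, hs)" "psi \<Phi> (B (n, hs)) hs (quotient_map (C (n, hs)) (S (n, hs)) hs j) = i"
    "\<And>k. k \<in> C (n, hs) \<Longrightarrow> ed (n, hs, i) k = (hs ! j) k"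
proof -
  let ?P = "\<lambda>j. j \<in> S (n, hs) \<and> psi \<Phi> (B (n, hs)) hs (quotient_map (C (n, hs)) (S (n, hs)) hs j) = i"
  obtain a where a: "a < num_classes (C (n, hs)) (S (n, hs)) hs" "psi \<Phi> (B (n, hs)) hs a = i"
    using i by (auto simp: copied_def)
  have "a \<in> quotient_map (C (n, hs)) (S (n, hs)) hs ` S (n, hs)"
    using a(1) image_quotient_map[OF finite_copyable[of "B (n, hs)" hs], of "C (n, hs)" hs] by simp
  then have "\<exists>j. ?P j" using a(2) by blast
  then have "?P (SOME j. ?P j)" by (rule someI_ex)
  then show thesis
    using that[of "SOME j. ?P j"] i by (auto simp: e_dot_def Let_def copied_def)
qed

lemma copied_lt: "(n, hs) \<in> Vectors \<Longrightarrow> i \<in> copied (n, hs) \<Longrightarrow> i < n"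
  using psi_free(1)[of n hs] by (auto simp: copied_def free_coords_def Vectors_def)

lemma copied_agreement_finite:
  assumes v: "(n, hs) \<in> Vectors" and i: "i \<in> copied (n, hs)"
  shows "finite {k \<in> C (n, hs). ed (n, hs, i) k = e_map f k}"
proof -
  obtain j where j: "j \<in> S (n, hs)" "\<And>k. k \<in> C (n, hs) \<Longrightarrow> ed (n, hs, i) k = (hs ! j) k"
    using ed_copied[OF v i] by metis
  have "{k \<in> C (n, hs). ed (n, hs, i) k = e_map f k}
      \<subseteq> {k \<in> stage (B (n, hs)) hs (length hs). (hs ! j) k = e_map f k}"
    using j copy_domain_subset[OF infinite_B, of rank "(n, hs)" hs] by auto
  then show ?thesis
    by (rule finite_subset) (use copyable_agreement_finite[OF infinite_B] j(1) in simp)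
qed

text \<open>Distinct copied coordinates belong to distinct classes, so the two copied coordinates of \<open>hs\<close>
  differ somewhere on \<open>C (n, hs)\<close>, and then everywhere on it because the equality pattern is constant
  there.\<close>

lemma copied_differ:
  assumes v: "(n, hs) \<in> Vectors" and i: "i \<in> copied (n, hs)" "i' \<in> copied (n, hs)" "i \<noteq> i'"
    and k: "k \<in> C (n, hs)"
  shows "ed (n, hs, i) k \<noteq> ed (n, hs, i') k"
proof
  assume eq: "ed (n, hs, i) k = ed (n, hs, i') k"
  let ?q = "quotient_map (C (n, hs)) (S (n, hs)) hs"
  obtain j where j: "j \<in> S (n, hs)" "psi \<Phi> (B (n, hs)) hs (?q j) = i"
    "\<And>k. k \<in> C (n, hs) \<Longrightarrow> ed (n, hs, i) k = (hs ! j) k"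
    using ed_copied[OF v i(1)] by metis
  obtain j' where j': "j' \<in> S (n, hs)" "psi \<Phi> (B (n, hs)) hs (?q j') = i'"
    "\<And>k. k \<in> C (n, hs) \<Longrightarrow> ed (n, hs, i') k = (hs ! j') k"
    using ed_copied[OF v i(2)] by metis
  have "(hs ! j) k = (hs ! j') k" using eq j(3) j'(3) k by simp
  then have "(hs ! j) l = (hs ! j') l" if "l \<in> C (n, hs)" for l
    using copy_domain_uniform[of j _ hs j' k rank l] j(1) j'(1) k that by simp
  then have "(j, j') \<in> sim (C (n, hs)) (S (n, hs)) hs"
    using j(1) j'(1) by (simp add: sim_def)
  then have "?q j = ?q j'"
    using quotient_map_eq_iff[OF finite_copyable j(1) j'(1)] by simp
  then show False using j(2) j'(2) i(3) by simp
qed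

text \<open>Where neither function copies, they agree finitely often because the values of \<open>\<Phi>\<close> differ.
  Where exactly one copies, its values agree with an \<open>e_map\<close> at finitely many points. Where both
  copy, either the index vectors are the same and the values differ, or they are different and the
  domains of copying are almost disjoint.\<close>

lemma pairwise_eventually_different:
  "pairwise (eventually_different UNIV) (E_family \<Phi> star code rank)"
proof (rule pairwiseI)
  fix f g assume "f \<in> E_family \<Phi> star code rank" "g \<in> E_family \<Phi> star code rank" and "f \<noteq> g"
  then obtain n hs i n' hs' i' where f: "f = ed (n, hs, i)" "(n, hs) \<in> Vectors" "i < n"
    and g: "g = ed (n', hs', i')" "(n', hs') \<in> Vectors" "i' < n'"
    by (auto simp: E_family_def Requirements_def)
  have ne: "(n, hs, i) \<noteq> (n', hs', i')" using f g \<open>f \<noteq> g\<close> by blast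
  let ?\<phi> = "\<Phi> (n, hs, i)" and ?\<phi>' = "\<Phi> (n', hs', i')"
  have "?\<phi> \<noteq> ?\<phi>'"
    using ne bij_Phi f g by (auto simp: bij_betw_def Requirements_def dest!: inj_onD)
  let ?C = "C (n, hs)" and ?C' = "C (n', hs')"
  \<comment> \<open>The agreements where only \<open>f\<close> copies, where only \<open>g\<close> copies, and where both copy.\<close>
  let ?K = "if i \<in> copied (n, hs) then {k \<in> ?C. f k = e_map ?\<phi>' k} else {}"
  let ?K' = "if i' \<in> copied (n', hs') then {k \<in> ?C'. g k = e_map ?\<phi> k} else {}"
  let ?D = "if (n, hs) = (n', hs') then {} else ?C \<inter> ?C'"
  have "{k. f k = g k} \<subseteq> {k. e_map ?\<phi> k = e_map ?\<phi>' k} \<union> ?K \<union> ?K' \<union> ?D"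
  proof
    fix k assume "k \<in> {k. f k = g k}"
    then have k: "f k = g k" by simp
    let ?c = "i \<in> copied (n, hs) \<and> k \<in> ?C" and ?c' = "i' \<in> copied (n', hs') \<and> k \<in> ?C'"
    have not_c: "f k = e_map ?\<phi> k" if "\<not> ?c" using ed_not_copying[of i n hs k] that f by blast
    have not_c': "g k = e_map ?\<phi>' k" if "\<not> ?c'" using ed_not_copying[of i' n' hs' k] that g by blast
    have "(n, hs) \<noteq> (n', hs')" if "?c" "?c'"
      using copied_differ[OF f(2), of i i' k] that k f g ne by auto
    then show "k \<in> {k. e_map ?\<phi> k = e_map ?\<phi>' k} \<union> ?K \<union> ?K' \<union> ?D"
      using not_c not_c' k by (cases ?c; cases ?c') auto
  qed
  moreover have "finite {k. e_map ?\<phi> k = e_map ?\<phi>' k}"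
    using finite_e_map_agreement[OF \<open>?\<phi> \<noteq> ?\<phi>'\<close>] .
  moreover have "finite ?K" "finite ?K'" using copied_agreement_finite f g by auto
  moreover have "finite ?D"
    using finite_B_Int_B[OF f(2) g(2)] finite_subset[OF Int_mono[OF C_subset_B C_subset_B]] by auto
  ultimately show "eventually_different UNIV f g"
    unfolding eventually_different_def by (simp add: finite_subset)
qed

text \<open>The capturing property behind maximality of all powers: on \<open>C (n, hs)\<close> every coordinate of \<open>hs\<close>
  agrees almost everywhere with a member of the family. A copyable coordinate is copied, up to its
  class. A coherent one is \<open>e_map b\<close> for its branch \<open>b\<close>, and \<open>b\<close> is a value \<open>\<Phi> (n', hs', i)\<close> by
  surjectivity. The member with this index can deviate from \<open>e_map b\<close> only by copying: if the index
  vector is \<open>(n, hs)\<close>, then \<open>i\<close> is not free and hence not copied; otherwise it copies only at finitely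
  many points of \<open>C (n, hs)\<close>.\<close>

lemma coordinate_met:
  assumes v: "(n, hs) \<in> Vectors" and j: "j < n"
  shows "\<exists>f\<in>E_family \<Phi> star code rank. finite {k \<in> C (n, hs). f k \<noteq> (hs ! j) k}"
proof (cases "j \<in> S (n, hs)")
  case True
  let ?q = "quotient_map (C (n, hs)) (S (n, hs)) hs"
  let ?i = "psi \<Phi> (B (n, hs)) hs (?q j)"
  let ?m = "num_classes (C (n, hs)) (S (n, hs)) hs"
  have q_image: "?q ` S (n, hs) = {..<?m}" by (rule image_quotient_map) simp
  have qj: "?q j \<in> {..<?m}" using True unfolding q_image[symmetric] by (rule imageI)
  from qj have i: "?i \<in> copied (n, hs)" by (auto simp: copied_def)
  obtain j' where j': "j' \<in> S (n, hs)" "psi \<Phi> (B (n, hs)) hs (?q j') = ?i"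
    "\<And>k. k \<in> C (n, hs) \<Longrightarrow> ed (n, hs, ?i) k = (hs ! j') k"
    using ed_copied[OF v i] by metis
  have qj': "?q j' \<in> {..<?m}" using j'(1) unfolding q_image[symmetric] by (rule imageI)
  have "?q j = ?q j'"
    by (rule inj_onD[OF psi_free(2)[OF v] _ qj qj']) (rule j'(2)[symmetric])
  then have "(j, j') \<in> sim (C (n, hs)) (S (n, hs)) hs"
    using quotient_map_eq_iff[OF finite_copyable True j'(1)] by simp
  then have "{k \<in> C (n, hs). ed (n, hs, ?i) k \<noteq> (hs ! j) k} = {}"
    using j'(3) by (auto simp: sim_def)
  then have fin: "finite {k \<in> C (n, hs). ed (n, hs, ?i) k \<noteq> (hs ! j) k}"
    by (rule ssubst) (rule finite.emptyI)
  have "(n, hs, ?i) \<in> Requirements"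
    using v copied_lt[OF v i] by (simp add: Requirements_def)
  then have "ed (n, hs, ?i) \<in> E_family \<Phi> star code rank"
    unfolding E_family_def by (rule imageI)
  with fin show ?thesis by (rule bexI)
next
  case False
  let ?b = "coherent_branch (B (n, hs)) hs j"
  have "length hs = n" using v by (simp add: Vectors_def)
  then have coh: "j \<in> coherent (B (n, hs)) hs" using False j by (simp add: coherent_def)
  have agree: "(hs ! j) k = e_map ?b k" if "k \<in> C (n, hs)" for k
  proof (rule coherent_eq_e_map[OF infinite_B coh])
    show "k \<in> stage (B (n, hs)) hs (length hs)"
      using copy_domain_subset[OF infinite_B, of rank "(n, hs)" hs] that by auto
  qed
  obtain r where "r \<in> Requirements" "\<Phi> r = ?b"
    using bij_Phi by (metis UNIV_I bij_betw_def imageE)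
  then obtain n' hs' i where r: "(n', hs') \<in> Vectors" "i < n'" "\<Phi> (n', hs', i) = ?b"
    "(n', hs', i) \<in> Requirements"
    by (auto simp: Requirements_def)
  have not_free: "i \<notin> copied (n, hs)" if "(n', hs') = (n, hs)"
    using psi_free(1)[OF v] coh r(3) that \<open>length hs = n\<close> by (auto simp: copied_def free_coords_def)
  have "{k \<in> C (n, hs). ed (n', hs', i) k \<noteq> (hs ! j) k}
      \<subseteq> (if (n', hs') = (n, hs) then {} else B (n', hs') \<inter> B (n, hs))"
  proof
    fix k assume "k \<in> {k \<in> C (n, hs). ed (n', hs', i) k \<noteq> (hs ! j) k}"
    then have k: "k \<in> C (n, hs)" "ed (n', hs', i) k \<noteq> e_map (\<Phi> (n', hs', i)) k"
      using agree r(3) by auto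
    then have "i \<in> copied (n', hs')" "k \<in> C (n', hs')" using ed_not_copying by blast+
    then show "k \<in> (if (n', hs') = (n, hs) then {} else B (n', hs') \<inter> B (n, hs))"
      using k(1) not_free C_subset_B[of "(n, hs)"] C_subset_B[of "(n', hs')"] by auto
  qed
  moreover have "finite (if (n', hs') = (n, hs) then {} else B (n', hs') \<inter> B (n, hs))"
    using finite_B_Int_B[OF r(1) v] by auto
  ultimately show ?thesis unfolding E_family_def using r(4) finite_subset by blast
qed

section \<open>Separating consecutive ideals\<close>

definition small_arity_codes :: "nat \<Rightarrow> nat set" where
  "small_arity_codes n = (\<Union>v\<in>{v \<in> Vectors. fst v \<le> n}. B v)"

lemma infinite_small_arity_codes:
  assumes "1 \<le> n"
  shows "infinite (small_arity_codes n)"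
proof -
  have "(1, [undefined]) \<in> {v \<in> Vectors. fst v \<le> n}" using assms by (simp add: Vectors_def)
  then have "B (1, [undefined]) \<subseteq> small_arity_codes n" unfolding small_arity_codes_def by blast
  then show ?thesis using infinite_B finite_subset by blast
qed

text \<open>The single vector \<open>(n, gs)\<close> captures all coordinates of \<open>gs\<close> on the same infinite set.\<close>

lemma power_maximal_on_small_arity_codes:
  assumes n: "1 \<le> n"
  shows "power_maximal_on (E_family \<Phi> star code rank) n (small_arity_codes n)"
  unfolding power_maximal_on_def
proof (intro allI impI)
  fix gs :: "seqfun list" assume len: "length gs = n"
  then have v: "(n, gs) \<in> Vectors" using n by (simp add: Vectors_def)
  define F where "F j = (SOME f. f \<in> E_family \<Phi> star code rank
      \<and> finite {k \<in> C (n, gs). f k \<noteq> (gs ! j) k})" for j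
  have F: "F j \<in> E_family \<Phi> star code rank \<and> finite {k \<in> C (n, gs). F j k \<noteq> (gs ! j) k}"
    if "j < n" for j
    unfolding F_def using coordinate_met[OF v that, unfolded Bex_def] by (rule someI_ex)
  let ?fs = "map F [0..<n]"
  let ?bad = "\<Union>j<n. {k \<in> C (n, gs). F j k \<noteq> (gs ! j) k}"
  have "C (n, gs) - ?bad \<subseteq> {a \<in> small_arity_codes n. fun_product ?fs a = fun_product gs a}"
  proof
    fix k assume k: "k \<in> C (n, gs) - ?bad"
    have "fun_product ?fs k = fun_product gs k"
      by (rule nth_equalityI) (use k len in \<open>auto simp: fun_product_def\<close>)
    moreover have "k \<in> small_arity_codes n"
      using k v C_subset_B[of "(n, gs)"] unfolding small_arity_codes_def by fastforce
    ultimately show "k \<in> {a \<in> small_arity_codes n. fun_product ?fs a = fun_product gs a}" by blast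
  qed
  moreover have "finite ?bad" using F by blast
  then have "infinite (C (n, gs) - ?bad)"
    using infinite_C[of "(n, gs)"] by (rule Diff_infinite_finite)
  ultimately have "infinite {a \<in> small_arity_codes n. fun_product ?fs a = fun_product gs a}"
    using finite_subset by blast
  moreover have "?fs \<in> set_power (E_family \<Phi> star code rank) n"
    using F by (auto simp: set_power_def)
  ultimately show "\<exists>fs\<in>set_power (E_family \<Phi> star code rank) n.
      infinite {a \<in> small_arity_codes n. fun_product fs a = fun_product gs a}" by blast
qed

text \<open>If \<open>v\<close> has a length different from that of \<open>w\<close>, then \<open>star v\<close> and \<open>star w\<close> differ already at
  \<open>0\<close>. So the only possible common element is the code of the empty sequence, the same one for all
  \<open>w\<close>.\<close>

lemma finite_B_Int_small_arity_codes:
  assumes v: "v \<in> Vectors" and n: "n < fst v"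
  shows "finite (B v \<inter> small_arity_codes n)"
proof -
  have "B v \<inter> B w \<subseteq> (\<lambda>k. 2 * code (initial_segment (star v) k) + 1) ` {..0}"
    if "w \<in> Vectors" "fst w \<le> n" for w
    using B_Int_B[of v 0 w] star_0[OF v that(1)] that(2) n by force
  then have "B v \<inter> small_arity_codes n
      \<subseteq> (\<lambda>k. 2 * code (initial_segment (star v) k) + 1) ` {..0}"
    unfolding small_arity_codes_def by blast
  then show ?thesis using finite_subset by blast
qed

text \<open>Simultaneous capturing forces a common index vector of length at most \<open>n\<close>, and the pigeonhole
  principle rules out capturing \<open>n + 1\<close> functions with distinct values.\<close>

lemma not_power_maximal_on_small_arity_codes:
  "\<not> power_maximal_on (E_family \<Phi> star code rank) (Suc n) (small_arity_codes n)"
proof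
  assume max: "power_maximal_on (E_family \<Phi> star code rank) (Suc n) (small_arity_codes n)"
  \<comment> \<open>The lengths \<open>a + 1 + i\<close> differ from the length \<open>a\<close> of the values of an \<open>e_map\<close> and from each
    other.\<close>
  let ?g = "\<lambda>i a. replicate (a + 1 + i) (0::nat)"
  let ?gs = "map ?g [0..<Suc n]"
  obtain fs where fs: "fs \<in> set_power (E_family \<Phi> star code rank) (Suc n)"
    and inf: "infinite {a \<in> small_arity_codes n. fun_product fs a = fun_product ?gs a}" (is "infinite ?Z")
    using max[unfolded power_maximal_on_def, rule_format, of ?gs] by (auto simp del: upt_Suc)
  have len: "length fs = Suc n" and mem: "set fs \<subseteq> E_family \<Phi> star code rank"
    using fs by (auto simp: set_power_def)
  have val: "(fs ! i) a = ?g i a" if "a \<in> ?Z" "i < Suc n" for a i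
  proof -
    have "fun_product fs a ! i = fun_product ?gs a ! i" using that by simp
    then show ?thesis using that len by (simp add: fun_product_def del: upt_Suc)
  qed
  have "\<forall>i<Suc n. \<exists>v c. v \<in> Vectors \<and> c < fst v \<and> fs ! i = ed (fst v, snd v, c)"
  proof (intro allI impI)
    fix i assume "i < Suc n"
    then have "fs ! i \<in> E_family \<Phi> star code rank" using len mem by (simp add: subset_iff)
    then obtain k hs c where "(k, hs) \<in> Vectors" "c < k" "fs ! i = ed (k, hs, c)"
      by (auto simp: E_family_def Requirements_def)
    then show "\<exists>v c. v \<in> Vectors \<and> c < fst v \<and> fs ! i = ed (fst v, snd v, c)"
      by (intro exI[of _ "(k, hs)"] exI[of _ c]) simp
  qed
  then obtain V c where Vc: "\<And>i. i < Suc n \<Longrightarrow>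
      V i \<in> Vectors \<and> c i < fst (V i) \<and> fs ! i = ed (fst (V i), snd (V i), c i)"
    by metis
  \<comment> \<open>A value of length other than \<open>a\<close> at \<open>a\<close> is possible only by copying.\<close>
  have Z_B: "?Z \<subseteq> B (V i)" if i: "i < Suc n" for i
  proof
    fix a assume a: "a \<in> ?Z"
    have "length ((fs ! i) a) \<noteq> a" using val[OF a i] by simp
    then have "(fs ! i) a \<noteq> e_map (\<Phi> (fst (V i), snd (V i), c i)) a" by auto
    then show "a \<in> B (V i)"
      using Vc[OF i] ed_not_copying[of "c i" "fst (V i)" "snd (V i)" a] C_subset_B[of "V i"]
      by auto
  qed
  have V: "V i = V 0" if i: "i < Suc n" for i
  proof (rule ccontr)
    assume "V i \<noteq> V 0"
    then have "finite (B (V i) \<inter> B (V 0))" using Vc[OF i] Vc[of 0] finite_B_Int_B by blast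
    moreover have "?Z \<subseteq> B (V i) \<inter> B (V 0)" using Z_B[OF i] Z_B[of 0] by blast
    ultimately show False using inf finite_subset by blast
  qed
  have "fst (V 0) \<le> n"
  proof (rule ccontr)
    assume "\<not> fst (V 0) \<le> n"
    then have "finite (B (V 0) \<inter> small_arity_codes n)"
      using Vc[of 0] finite_B_Int_small_arity_codes by simp
    moreover have "?Z \<subseteq> B (V 0) \<inter> small_arity_codes n" using Z_B[of 0] by blast
    ultimately show False using inf finite_subset by blast
  qed
  then have "c i < n" if "i < Suc n" for i
    using Vc[OF that] V[OF that] by simp
  then have "c ` {..<Suc n} \<subseteq> {..<n}" by blast
  then have "\<not> inj_on c {..<Suc n}"
    using card_inj_on_le[of c "{..<Suc n}" "{..<n}"] by auto
  then obtain i j where ij: "i < Suc n" "j < Suc n" "c i = c j" "i \<noteq> j" by (auto simp: inj_on_def)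
  then have "fs ! i = fs ! j" using Vc[OF ij(1)] Vc[OF ij(2)] V[OF ij(1)] V[OF ij(2)] by simp
  obtain a where a: "a \<in> ?Z" using infinite_imp_nonempty[OF inf] by blast
  have "length ((fs ! i) a) = a + 1 + i" "length ((fs ! j) a) = a + 1 + j"
    unfolding val[OF a ij(1)] val[OF a ij(2)] by simp_all
  with \<open>fs ! i = fs ! j\<close> show False using ij(4) by simp
qed

end

theorem lemma5p4:
  fixes \<Phi> :: "nat \<times> (nat \<Rightarrow> nat list) list \<times> nat \<Rightarrow> nat \<Rightarrow> nat"
    and star :: "nat \<times> (nat \<Rightarrow> nat list) list \<Rightarrow> nat \<Rightarrow> nat list"
    and code :: "nat list list \<Rightarrow> nat"
    and rank :: "nat set \<Rightarrow> (nat \<times> nat) set \<Rightarrow> nat"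
    and E :: "(nat \<Rightarrow> nat list) set"
  assumes "admissible_Phi \<Phi>"
    and "admissible_star star"
    and "admissible_code code"
    and "admissible_rank rank"
  defines "E \<equiv> E_family \<Phi> star code rank"
  shows "ideal0 UNIV E \<subset> ideal0 (set_power UNIV 2) (family_power E 2) \<and>
    (\<forall>n\<ge>2. ideal0 (set_power UNIV n) (family_power E n)
            \<subset> ideal0 (set_power UNIV (n + 1)) (family_power E (n + 1)))"
proof -
  interpret ed_construction \<Phi> star code rank
  proof
    show "bij_betw \<Phi> Requirements UNIV" using assms(1) by (simp add: admissible_Phi_def)
    show "inj_on star Vectors" using assms(2) by (simp add: admissible_star_def)
    show "fst v = fst v'" if "v \<in> Vectors" "v' \<in> Vectors" "star v 0 = star v' 0" for v v'
      using assms(2) that unfolding admissible_star_def by (cases v; cases v') fastforce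
    show "inj code" using assms(3) by (simp add: admissible_code_def)
  qed
  note ed_E = pairwise_eventually_different[folded E_def]
  let ?I = "\<lambda>n. {A. infinite A \<longrightarrow> \<not> power_maximal_on E n A}"
  have strict: "?I n \<subset> ?I (Suc n)" if "1 \<le> n" for n
  proof
    show "?I n \<subseteq> ?I (Suc n)" using power_maximal_on_Suc_imp by blast
    have "small_arity_codes n \<in> ?I (Suc n) - ?I n"
      using not_power_maximal_on_small_arity_codes[of n] infinite_small_arity_codes[OF that]
        power_maximal_on_small_arity_codes[OF that] unfolding E_def by simp
    then show "?I n \<noteq> ?I (Suc n)" by blast
  qed
  show ?thesis
    unfolding ideal0_eq_power_1[OF ed_E] ideal0_family_power[OF ed_E]
    using strict[of 1] strict by (simp add: numeral_2_eq_2)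
qed

end
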